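(* Let $k\ge 2$, $\mathcal{A}_k=\{1,\dots,k\}$, and let $X$ be an Arnoux-Rauzy subshift over $\mathcal{A}_k$ with index sequence $(i_n)_{n\ge1}$. Then $$\mathrm{ind}(X)=\max\{N_1,N_2\},$$ where $$N_1=1+\sup\{r\in\mathbb{N}: (i_n)\text{ contains an open } r\text{-run}\},\qquad N_2=2+\sup\{r\in\mathbb{N}:(i_n)\text{ contains a closed } r\text{-run}\}$$ (all quantities taking values in $\mathbb{N}\cup\{\infty\}$).
   Context: $\mathbb{N}=\{1,2,\dots\}$. For $x\in\mathcal{A}_k^{\mathbb{N}}$ or $\mathcal{A}_k^{\mathbb{Z}}$, $F_x(n)$ is the set of factors (contiguous subwords) of $x$ of length $n$, and $F_x=\bigcup_n F_x(n)$. A factor $u$ is right-special if there are letters $a\ne b$ with $ua,ub\in F_x$; left-special if there are $a\neq b$ with $au,bu\in F_x$; bispecial if both. The empty word $\varepsilon$ is counted as a bispecial factor. The sequence $x$ is an Arnoux-Rauzy (AR) sequence if (1) $x$ is uniformly recurrent (each factor occurs with bounded gaps), (2) $|F_x(n)|=(k-1)n+1$ for all $n\in\mathbb{N}$, and (3) for each $n$, $F_x(n)$ contains exactly one right-special factor and exactly one left-special factor. The associated AR subshift is $X=\{y\in\mathcal{A}_k^{\mathbb{N}} \text{ (or } \mathcal{A}_k^{\mathbb{Z}}) : F_y(n)=F_x(n)\ \forall n\in\mathbb{N}\}$; all its elements have the same factors, and one writes $F_X$ for $F_x$. Index sequence: let $\varepsilon=w_1,w_2,w_3,\dots$ be the bispecial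 factors ordered so that $0=|w_1|<|w_2|<\cdots$. Then $i_n\in\mathcal{A}_k$ is the unique letter such that $i_nw_n$ is right-special. An $r$-run in $(i_n)$ is a pair $(a,l)\in\mathcal{A}_k\times\mathbb{N}$ such that $i_m=a$ for $l\le m\le l+r-1$. It is open if $i_m\ne a$ for all $1\le m\le l-1$; otherwise it is closed. The (integer) index of $X$ is $\mathrm{ind}(X)=\sup\{p\in\mathbb{N}:\text{ there exists a nonempty word } u \text{ over } \mathcal{A}_k \text{ with } u^p\in F_X\}\in\mathbb{N}\cup\{\infty\}$. *)

theory Defs
  imports Main "HOL-Library.Extended_Nat" "HOL-Library.Infinite_Set"
begin

text \<open>One-sided sequences are functions on \<^typ>\<open>nat\<close>, two-sided ones functions on \<^typ>\<open>int\<close>; the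
  position type \<open>'i\<close> below is only meant to be instantiated with these two types. Words are lists.\<close>

definition alphabet :: "nat \<Rightarrow> nat set" where
  "alphabet k = {1..k}"

definition word_at :: "('i::semiring_1 \<Rightarrow> 'a) \<Rightarrow> 'i \<Rightarrow> nat \<Rightarrow> 'a list" where
  "word_at x i n = map (\<lambda>j. x (i + of_nat j)) [0..<n]"

definition factors_of_length :: "('i::semiring_1 \<Rightarrow> 'a) \<Rightarrow> nat \<Rightarrow> 'a list set" where
  "factors_of_length x n = {word_at x i n |i. True}"

text \<open>The union includes \<open>n = 0\<close>, so that the empty word is a factor.\<close>

definition factors :: "('i::semiring_1 \<Rightarrow> 'a) \<Rightarrow> 'a list set" where
  "factors x = (\<Union>n. factors_of_length x n)"

definition right_special :: "'a list set \<Rightarrow> 'a list \<Rightarrow> bool" where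
  "right_special F u \<longleftrightarrow> u \<in> F \<and> (\<exists>a b. a \<noteq> b \<and> u @ [a] \<in> F \<and> u @ [b] \<in> F)"

definition left_special :: "'a list set \<Rightarrow> 'a list \<Rightarrow> bool" where
  "left_special F u \<longleftrightarrow> u \<in> F \<and> (\<exists>a b. a \<noteq> b \<and> a # u \<in> F \<and> b # u \<in> F)"

definition bispecial :: "'a list set \<Rightarrow> 'a list \<Rightarrow> bool" where
  "bispecial F u \<longleftrightarrow> left_special F u \<and> right_special F u"

definition uniformly_recurrent :: "('i::semiring_1 \<Rightarrow> 'a) \<Rightarrow> bool" where
  "uniformly_recurrent x \<longleftrightarrow>
     (\<forall>u\<in>factors x. \<exists>N. \<forall>i. \<exists>j<N. word_at x (i + of_nat j) (length u) = u)"

definition AR_sequence :: "nat \<Rightarrow> ('i::semiring_1 \<Rightarrow> nat) \<Rightarrow> bool" where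
  "AR_sequence k x \<longleftrightarrow>
     range x \<subseteq> alphabet k \<and>
     uniformly_recurrent x \<and>
     (\<forall>n\<ge>1. card (factors_of_length x n) = (k - 1) * n + 1) \<and>
     (\<forall>n\<ge>1. (\<exists>!u. u \<in> factors_of_length x n \<and> right_special (factors x) u) \<and>
             (\<exists>!u. u \<in> factors_of_length x n \<and> left_special (factors x) u))"

definition AR_subshift :: "nat \<Rightarrow> ('i::semiring_1 \<Rightarrow> nat) set \<Rightarrow> bool" where
  "AR_subshift k X \<longleftrightarrow>
     (\<exists>x :: 'i \<Rightarrow> nat. AR_sequence k x \<and>
          X = {y. range y \<subseteq> alphabet k \<and>
                  (\<forall>n\<ge>1. factors_of_length y n = factors_of_length x n)})"

text \<open>All elements of an Arnoux-Rauzy subshift have the same factors, so this is the factor set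
  of any one of them.\<close>

definition language :: "('i::semiring_1 \<Rightarrow> 'a) set \<Rightarrow> 'a list set" where
  "language X = (\<Union>x\<in>X. factors x)"

text \<open>In the next two definitions \<open>n\<close> starts at 1, whereas \<^const>\<open>enumerate\<close> counts from 0;
  thus \<open>bispecial_word X 1\<close> is the empty word. The values at \<open>n = 0\<close> are irrelevant.\<close>

definition bispecial_word :: "('i::semiring_1 \<Rightarrow> 'a) set \<Rightarrow> nat \<Rightarrow> 'a list" where
  "bispecial_word X n =
     (THE w. bispecial (language X) w \<and>
             length w = enumerate (length ` {u. bispecial (language X) u}) (n - 1))"

definition index_seq :: "('i::semiring_1 \<Rightarrow> 'a) set \<Rightarrow> nat \<Rightarrow> 'a" where
  "index_seq X n = (THE a. right_special (language X) (a # bispecial_word X n))"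

definition run :: "nat \<Rightarrow> (nat \<Rightarrow> nat) \<Rightarrow> nat \<Rightarrow> nat \<Rightarrow> nat \<Rightarrow> bool" where
  "run k i r a l \<longleftrightarrow> a \<in> alphabet k \<and> l \<ge> 1 \<and> (\<forall>m. l \<le> m \<and> m < l + r \<longrightarrow> i m = a)"

definition open_run :: "nat \<Rightarrow> (nat \<Rightarrow> nat) \<Rightarrow> nat \<Rightarrow> nat \<Rightarrow> nat \<Rightarrow> bool" where
  "open_run k i r a l \<longleftrightarrow> run k i r a l \<and> (\<forall>m. 1 \<le> m \<and> m < l \<longrightarrow> i m \<noteq> a)"

definition closed_run :: "nat \<Rightarrow> (nat \<Rightarrow> nat) \<Rightarrow> nat \<Rightarrow> nat \<Rightarrow> nat \<Rightarrow> bool" where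
  "closed_run k i r a l \<longleftrightarrow> run k i r a l \<and> \<not> open_run k i r a l"

definition word_power :: "'a list \<Rightarrow> nat \<Rightarrow> 'a list" where
  "word_power u p = concat (replicate p u)"

definition ind :: "nat \<Rightarrow> ('i::semiring_1 \<Rightarrow> nat) set \<Rightarrow> enat" where
  "ind k X = Sup {enat p |p. p \<ge> 1 \<and>
     (\<exists>u. u \<noteq> [] \<and> set u \<subseteq> alphabet k \<and> word_power u p \<in> language X)}"

definition N1 :: "nat \<Rightarrow> (nat \<Rightarrow> nat) \<Rightarrow> enat" where
  "N1 k i = 1 + Sup {enat r |r. r \<ge> 1 \<and> (\<exists>a l. open_run k i r a l)}"

definition N2 :: "nat \<Rightarrow> (nat \<Rightarrow> nat) \<Rightarrow> enat" where
  "N2 k i = 2 + Sup {enat r |r. r \<ge> 1 \<and> (\<exists>a l. closed_run k i r a l)}"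

end

theory Submission
  imports Defs
begin

text \<open>Why the theorem holds. Let \<open>w\<close> be a bispecial word of the language \<open>F\<close>. It is the only right-special
  word of its length, so after an occurrence of \<open>w\<close> followed by a letter \<open>a\<close> the sequence is forced
  until \<open>w\<close> occurs again. Hence for each letter \<open>a\<close> there is exactly one return word \<open>u\<^sub>a\<close>: the
  word \<open>u\<^sub>aw\<close> starts with \<open>wa\<close> and contains \<open>w\<close> only as a prefix and as a suffix.

  These return words determine all powers. In \<open>u\<^sub>aw\<close> the word \<open>w\<close> is also a prefix, so \<open>u\<^sub>aw\<close> has
  period \<open>|u\<^sub>a|\<close> and starts with a power of \<open>u\<^sub>a\<close> of exponent \<open>1 + \<lfloor>|w| / |u\<^sub>a|\<rfloor>\<close>. Conversely, a factor
  \<open>v\<^sup>p\<close> extends to a maximal factor of period \<open>|v|\<close>. Its prefix and its suffix that arise by cutting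
  off one period are the same word, and by maximality that word is bispecial; so \<open>|v|\<close> is at least
  the length of one of its return words, and \<open>p\<close> is at most the corresponding exponent. Therefore
  the index is the supremum of \<open>1 + \<lfloor>|w| / |u\<^sub>a|\<rfloor>\<close> over all bispecial words \<open>w\<close> and all letters
  \<open>a\<close> (\<open>ind_eq\<close>).

  The lengths obey a simple recursion. If \<open>i\<close> is the letter for which \<open>iw\<close> is right-special, then
  the next bispecial word is \<open>u\<^sub>iw\<close>, the return word for \<open>i\<close> stays the same, and \<open>u\<^sub>a\<close> becomes
  \<open>u\<^sub>iu\<^sub>a\<close> for \<open>a \<noteq> i\<close> (\<open>return_system_next\<close>, \<open>bispecial_next\<close>). This step needs that \<open>wi\<close> is
  left-special with the same \<open>i\<close> (\<open>left_special_special_letter\<close>), which follows from recurrence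
  and from the invariant that \<open>u\<^sub>a\<close> ends with \<open>a\<close>.

  The rest is arithmetic on lengths (\<open>Sup_exponents\<close>). Each step that reads \<open>a\<close> raises
  \<open>\<lfloor>|w| / |u\<^sub>a|\<rfloor>\<close> by \<open>1\<close>. Just before a run of \<open>a\<close> that is maximal to the left, the quotient is \<open>0\<close> if
  \<open>a\<close> has not been read before, because then \<open>|u\<^sub>a| = |w| + 1\<close>, and it is \<open>1\<close> otherwise, because
  \<open>|u\<^sub>a| \<le> |w| < 2|u\<^sub>a|\<close>. So an open \<open>r\<close>-run yields the exponent \<open>r + 1\<close> and a closed one that is
  maximal to the left yields \<open>r + 2\<close>.\<close>

section \<open>Languages with one special word of each length\<close>

lemma mem_rev_image: "v \<in> rev ` F \<longleftrightarrow> rev v \<in> F"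
  by (metis image_iff rev_rev_ident)

lemma right_special_rev: "right_special (rev ` F) (rev u) \<longleftrightarrow> left_special F u"
  by (simp add: right_special_def left_special_def mem_rev_image)

lemma left_special_rev: "left_special (rev ` F) (rev u) \<longleftrightarrow> right_special F u"
  using right_special_rev[of "rev ` F" "rev u"] by (simp add: image_image)

text \<open>Every word of length \<open>n\<close> other than \<open>R\<close> has exactly one right extension, so the growth of the
  number of words from length \<open>n\<close> to \<open>n + 1\<close> is the number of extensions of \<open>R\<close> minus one. A growth
  by \<open>card A - 1\<close> therefore makes all letters possible after \<open>R\<close>.\<close>

lemma unique_right_special_full:
  fixes G :: "'a list set"
  assumes fin: "finite A" and alph: "\<And>u. u \<in> G \<Longrightarrow> set u \<subseteq> A"
    and pre: "\<And>u c. u @ [c] \<in> G \<Longrightarrow> u \<in> G" and ext: "\<And>u. u \<in> G \<Longrightarrow> \<exists>c. u @ [c] \<in> G"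
    and uniq: "\<And>u. right_special G u \<Longrightarrow> length u = n \<Longrightarrow> u = R"
    and R: "R \<in> G" "length R = n"
    and card: "card {u \<in> G. length u = Suc n} + 1 = card {u \<in> G. length u = n} + card A"
    and c: "c \<in> A"
  shows "R @ [c] \<in> G"
proof -
  define E where "E u = {c. u @ [c] \<in> G}" for u
  define Gn where "Gn = {u \<in> G. length u = n}"
  have EA: "E u \<subseteq> A" for u using alph unfolding E_def by fastforce
  then have finE: "finite (E u)" for u using fin finite_subset by blast
  have "Gn \<subseteq> {u. set u \<subseteq> A \<and> length u = n}" using alph by (auto simp: Gn_def)
  then have finG: "finite Gn" using finite_lists_length_eq[OF fin] finite_subset by blast
  have RG: "R \<in> Gn" using R by (simp add: Gn_def)
  have one: "card (E u) = 1" if "u \<in> Gn - {R}" for u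
  proof -
    have u: "u \<in> G" "\<not> right_special G u" using that uniq by (auto simp: Gn_def)
    obtain c where "c \<in> E u" using ext u by (auto simp: E_def)
    moreover have "d = c" if "d \<in> E u" for d
      using that \<open>c \<in> E u\<close> u by (auto simp: E_def right_special_def)
    ultimately have "E u = {c}" by blast
    then show ?thesis by simp
  qed
  have "{u \<in> G. length u = Suc n} = (\<lambda>(u, c). u @ [c]) ` Sigma Gn E"
  proof (intro equalityI subsetI)
    fix u assume "u \<in> {u \<in> G. length u = Suc n}"
    then have u: "u \<in> G" "length u = Suc n" by auto
    then obtain v c where v: "u = v @ [c]" by (metis append_butlast_last_id list.size(3) nat.distinct(1))
    then have "(v, c) \<in> Sigma Gn E" using u pre by (auto simp: Gn_def E_def)
    then show "u \<in> (\<lambda>(u, c). u @ [c]) ` Sigma Gn E" using v by force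
  qed (auto simp: Gn_def E_def)
  moreover have "inj_on (\<lambda>(u, c). u @ [c]) (Sigma Gn E)" by (auto simp: inj_on_def)
  ultimately have "card {u \<in> G. length u = Suc n} = card (Sigma Gn E)" by (simp add: card_image)
  also have "\<dots> = (\<Sum>u\<in>Gn. card (E u))" using finG finE by simp
  also have "\<dots> = card (E R) + (\<Sum>u\<in>Gn - {R}. card (E u))" by (rule sum.remove[OF finG RG])
  also have "(\<Sum>u\<in>Gn - {R}. card (E u)) = card Gn - 1" using one finG RG by simp
  finally have "card (E R) + (card Gn - 1) + 1 = card Gn + card A" using card by (simp add: Gn_def)
  moreover have "card Gn > 0" using finG RG by (auto simp: card_gt_0_iff)
  ultimately have "card (E R) = card A" by simp
  then have "E R = A" using card_subset_eq[OF fin EA] by blast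
  then show ?thesis using c by (auto simp: E_def)
qed

text \<open>The properties of the set of factors of an Arnoux-Rauzy sequence from which everything else
  follows. They are invariant under reversal of words, so that each statement about extensions to
  the right has a mirror image. The word counts are replaced by their consequence that a special word
  extends by every letter.\<close>

locale AR_language =
  fixes k :: nat and F :: "nat list set"
  assumes k2: "k \<ge> 2"
    and letters: "u \<in> F \<Longrightarrow> set u \<subseteq> {1..k}"
    and factorial: "x @ u @ y \<in> F \<Longrightarrow> u \<in> F"
    and extend_right: "u \<in> F \<Longrightarrow> \<exists>c. u @ [c] \<in> F"
    and extend_left: "u \<in> F \<Longrightarrow> \<exists>c. c # u \<in> F"
    and recurrent: "u \<in> F \<Longrightarrow> \<exists>N. \<forall>v\<in>F. N \<le> length v \<longrightarrow> (\<exists>x y. v = x @ u @ y)"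
    and right_special_exists: "\<exists>u. length u = n \<and> right_special F u"
    and left_special_exists: "\<exists>u. length u = n \<and> left_special F u"
    and right_special_unique: "right_special F u \<Longrightarrow> right_special F v \<Longrightarrow> length u = length v \<Longrightarrow> u = v"
    and left_special_unique: "left_special F u \<Longrightarrow> left_special F v \<Longrightarrow> length u = length v \<Longrightarrow> u = v"
    and right_special_full: "right_special F u \<Longrightarrow> c \<in> {1..k} \<Longrightarrow> u @ [c] \<in> F"
    and left_special_full: "left_special F u \<Longrightarrow> c \<in> {1..k} \<Longrightarrow> c # u \<in> F"

section \<open>The language of an Arnoux-Rauzy subshift\<close>

lemma length_word_at [simp]: "length (word_at x i n) = n"
  by (simp add: word_at_def)

lemma word_at_add: "word_at x i (m + n) = word_at x i m @ word_at x (i + of_nat m) n"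
  by (rule nth_equalityI) (auto simp: word_at_def nth_append add.assoc simp flip: of_nat_add)

lemma factors_of_length_eq: "factors_of_length x n = {u \<in> factors x. length u = n}"
  by (auto simp: factors_def factors_of_length_def)

lemma factors_iff: "u \<in> factors x \<longleftrightarrow> (\<exists>i. u = word_at x i (length u))"
  by (auto simp: factors_def factors_of_length_def)

lemma factors_factorial:
  assumes "p @ u @ q \<in> factors x" shows "u \<in> factors x"
proof -
  obtain i where "p @ u @ q = word_at x i (length p + (length u + length q))"
    using assms by (auto simp: factors_iff)
  then show ?thesis by (auto simp: word_at_add factors_iff)
qed

lemma factors_extend_right:
  assumes "u \<in> factors x" shows "\<exists>c. u @ [c] \<in> factors x"
proof -
  obtain i where i: "u = word_at x i (length u)" using assms by (auto simp: factors_iff)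
  have "word_at x i (length u + 1) = u @ word_at x (i + of_nat (length u)) 1"
    using word_at_add[of x i "length u" 1] i by simp
  then have "word_at x i (length u + 1) = u @ [x (i + of_nat (length u))]"
    by (simp add: word_at_def)
  then show ?thesis by (metis factors_iff length_word_at)
qed

text \<open>An occurrence of the word to the right of position \<open>1\<close> has a letter before it, also in a
  one-sided sequence.\<close>

lemma factors_extend_left:
  assumes "uniformly_recurrent x" "u \<in> factors x" shows "\<exists>c. c # u \<in> factors x"
proof -
  obtain j where j: "word_at x (1 + of_nat j) (length u) = u"
    using assms unfolding uniformly_recurrent_def by blast
  have "word_at x (of_nat j) (1 + length u) = [x (of_nat j)] @ u"
    using j unfolding word_at_add by (simp add: word_at_def add.commute)
  then have "x (of_nat j) # u = word_at x (of_nat j) (length (x (of_nat j) # u))" by simp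
  then show ?thesis using factors_iff by blast
qed

lemma factors_recurrent:
  assumes "uniformly_recurrent x" "u \<in> factors x"
  shows "\<exists>N. \<forall>v\<in>factors x. N \<le> length v \<longrightarrow> (\<exists>p q. v = p @ u @ q)"
proof -
  obtain N where N: "\<And>i. \<exists>j<N. word_at x (i + of_nat j) (length u) = u"
    using assms unfolding uniformly_recurrent_def by blast
  have "\<exists>p q. v = p @ u @ q" if v: "v \<in> factors x" "N + length u \<le> length v" for v
  proof -
    obtain i where i: "v = word_at x i (length v)" using v by (auto simp: factors_iff)
    obtain j where j: "j < N" "word_at x (i + of_nat j) (length u) = u" using N by blast
    have "length v = j + (length u + (length v - j - length u))" using j v by simp
    then have "v = word_at x i (j + (length u + (length v - j - length u)))" using i by metis
    then show ?thesis using j by (auto simp: word_at_add)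
  qed
  then show ?thesis by blast
qed

lemma set_factors_subset:
  assumes "range x \<subseteq> alphabet k" "u \<in> factors x" shows "set u \<subseteq> {1..k}"
proof -
  obtain i where "u = word_at x i (length u)" using assms by (auto simp: factors_iff)
  then have "set u \<subseteq> range x" by (metis (no_types, lifting) image_subsetI list.set_map rangeI word_at_def)
  then show ?thesis using assms(1) by (auto simp: alphabet_def)
qed

text \<open>The definition of an Arnoux-Rauzy sequence speaks about positive lengths. At length \<open>0\<close> the
  empty word is special because \<open>k\<close> words of length \<open>1\<close> over \<open>k\<close> letters are all of them. The
  counting lemma applied to the reversed language gives the extensions to the left.\<close>

lemma AR_language_factors:
  assumes k2: "k \<ge> 2" and AR: "AR_sequence k x"
  shows "AR_language k (factors x)"
proof -
  let ?F = "factors x"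
  have ur: "uniformly_recurrent x" and ran: "range x \<subseteq> alphabet k"
    and cd: "\<And>n. n \<ge> 1 \<Longrightarrow> card {u \<in> ?F. length u = n} = (k - 1) * n + 1"
    and rs: "\<And>n. n \<ge> 1 \<Longrightarrow> \<exists>!u. u \<in> {u \<in> ?F. length u = n} \<and> right_special ?F u"
    and ls: "\<And>n. n \<ge> 1 \<Longrightarrow> \<exists>!u. u \<in> {u \<in> ?F. length u = n} \<and> left_special ?F u"
    using AR unfolding AR_sequence_def factors_of_length_eq by auto
  note alph = set_factors_subset[OF ran]
  have nil: "[] \<in> ?F" by (auto simp: factors_iff word_at_def)
  have "{u \<in> ?F. length u = 0} = {[]}" using nil by auto
  then have cd': "card {u \<in> ?F. length u = n} = (k - 1) * n + 1" for n
    by (cases n) (use cd in auto)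
  have cardS: "card {u \<in> ?F. length u = Suc n} + 1 = card {u \<in> ?F. length u = n} + card {1..k}" for n
    using cd'[of n] cd'[of "Suc n"] k2 by simp
  have letter: "[c] \<in> ?F" if "c \<in> {1..k}" for c
  proof -
    have sub: "{u \<in> ?F. length u = 1} \<subseteq> (\<lambda>c. [c]) ` {1..k}"
      using alph by (fastforce simp: length_Suc_conv)
    have "card ((\<lambda>c. [c]) ` {1..k}) = k" by (simp add: card_image inj_on_def)
    then have "{u \<in> ?F. length u = 1} = (\<lambda>c. [c]) ` {1..k}"
      using card_subset_eq[OF _ sub] cd[of 1] k2 by simp
    then show ?thesis using that by auto
  qed
  have "[1] \<in> ?F" "[2] \<in> ?F" using letter k2 by auto
  then have nil_sp: "right_special ?F []" "left_special ?F []"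
    unfolding right_special_def left_special_def using nil
    by (metis append_Nil one_eq_numeral_iff num.distinct(1))+
  have rs_ex: "\<exists>u. length u = n \<and> right_special ?F u" for n
    using rs[of n] nil_sp by (cases n) auto
  have ls_ex: "\<exists>u. length u = n \<and> left_special ?F u" for n
    using ls[of n] nil_sp by (cases n) auto
  have rs_un: "u = v" if "right_special ?F u" "right_special ?F v" "length u = length v" for u v
  proof (cases "length u \<ge> 1")
    case True
    have "u \<in> ?F" "v \<in> ?F" using that by (auto simp: right_special_def)
    then show ?thesis using rs[OF True] that by (metis (mono_tags, lifting) mem_Collect_eq)
  qed (use that in \<open>auto simp: not_le\<close>)
  have ls_un: "u = v" if "left_special ?F u" "left_special ?F v" "length u = length v" for u v
  proof (cases "length u \<ge> 1")
    case True
    have "u \<in> ?F" "v \<in> ?F" using that by (auto simp: left_special_def)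
    then show ?thesis using ls[OF True] that by (metis (mono_tags, lifting) mem_Collect_eq)
  qed (use that in \<open>auto simp: not_le\<close>)
  have pre: "u \<in> ?F" if "u @ [c] \<in> ?F" for u c using factors_factorial[of "[]" u "[c]"] that by simp
  have suf: "u \<in> ?F" if "c # u \<in> ?F" for u c using factors_factorial[of "[c]" u "[]"] that by simp
  have rs_full: "u @ [c] \<in> ?F" if "right_special ?F u" "c \<in> {1..k}" for u c
  proof (rule unique_right_special_full[of "{1..k}" ?F "length u" u c])
    show "card {v \<in> ?F. length v = Suc (length u)} + 1 = card {v \<in> ?F. length v = length u} + card {1..k}"
      by (rule cardS)
    show "u \<in> ?F" using that by (simp add: right_special_def)
    show "v = u" if "right_special ?F v" "length v = length u" for v
      using rs_un that \<open>right_special ?F u\<close> by blast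
    show "set v \<subseteq> {1..k}" if "v \<in> ?F" for v using that by (rule alph)
    show "v \<in> ?F" if "v @ [d] \<in> ?F" for v d using that by (rule pre)
  qed (use that in \<open>simp_all add: factors_extend_right\<close>)
  have ls_full: "c # u \<in> ?F" if u: "left_special ?F u" and c: "c \<in> {1..k}" for u c
  proof -
    have len: "card {v \<in> rev ` ?F. length v = n} = card {v \<in> ?F. length v = n}" for n
    proof -
      have "{v \<in> rev ` ?F. length v = n} = rev ` {v \<in> ?F. length v = n}" by auto
      then show ?thesis by (simp add: card_image)
    qed
    have "rev u @ [c] \<in> rev ` ?F"
    proof (rule unique_right_special_full[of "{1..k}" "rev ` ?F" "length u" "rev u" c])
      show "card {v \<in> rev ` ?F. length v = Suc (length u)} + 1
          = card {v \<in> rev ` ?F. length v = length u} + card {1..k}"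
        using cardS by (simp add: len)
      show "v = rev u" if "right_special (rev ` ?F) v" "length v = length u" for v
        using that ls_un[of "rev v" u] u right_special_rev[of ?F "rev v"] by auto
      show "v \<in> rev ` ?F" if "v @ [d] \<in> rev ` ?F" for v d
        using that suf by (auto simp: mem_rev_image)
      show "\<exists>d. v @ [d] \<in> rev ` ?F" if "v \<in> rev ` ?F" for v
        using that factors_extend_left[OF ur] by (auto simp: mem_rev_image)
      show "set v \<subseteq> {1..k}" if "v \<in> rev ` ?F" for v using that alph by fastforce
      show "rev u \<in> rev ` ?F" using u by (simp add: left_special_def)
    qed (use c in simp_all)
    then show ?thesis by (simp add: mem_rev_image)
  qed
  show ?thesis
  proof
    show "u \<in> ?F" if "p @ u @ q \<in> ?F" for p u q using that by (rule factors_factorial)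
  qed (fact k2 alph factors_extend_right factors_extend_left[OF ur] factors_recurrent[OF ur]
      rs_ex ls_ex rs_un ls_un rs_full ls_full)+
qed

lemma language_AR_subshift:
  fixes X :: "('i::semiring_1 \<Rightarrow> nat) set"
  assumes "k \<ge> 2" "AR_subshift k X"
  shows "AR_language k (language X)"
proof -
  obtain x :: "'i \<Rightarrow> nat" where x: "AR_sequence k x"
    and X: "X = {y. range y \<subseteq> alphabet k \<and> (\<forall>n\<ge>1. factors_of_length y n = factors_of_length x n)}"
    using assms by (auto simp: AR_subshift_def)
  have zero: "factors_of_length y 0 = {[]}" for y :: "'i \<Rightarrow> nat"
    by (auto simp: factors_of_length_def word_at_def)
  have "factors y = factors x" if "y \<in> X" for y
  proof -
    have "factors_of_length y n = factors_of_length x n" for n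
      using that X zero by (cases n) auto
    then show ?thesis by (simp add: factors_def)
  qed
  moreover have "x \<in> X" using x X by (auto simp: AR_sequence_def)
  ultimately have "language X = factors x" unfolding language_def by blast
  then show ?thesis using AR_language_factors assms x by simp
qed

section \<open>Complete return words\<close>

text \<open>The word \<open>z\<close> runs from one occurrence of \<open>w\<close> to the next. The letter \<open>a\<close> after the first
  occurrence is also the letter before the last one; that both agree is part of the
  definition because it makes the notion symmetric and survives the passage to the next bispecial
  word.\<close>

definition complete_return :: "'a list set \<Rightarrow> 'a list \<Rightarrow> 'a \<Rightarrow> 'a list \<Rightarrow> bool" where
  "complete_return F w a z \<longleftrightarrow> z \<in> F \<and> (\<exists>t. z = w @ a # t) \<and> (\<exists>h. z = h @ a # w) \<and>
     (\<forall>x y. z = x @ w @ y \<longrightarrow> x = [] \<or> y = [])"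

lemma complete_return_rev:
  assumes "complete_return F w a z" shows "complete_return (rev ` F) (rev w) a (rev z)"
proof -
  obtain t h where th: "z = w @ a # t" "z = h @ a # w"
    using assms unfolding complete_return_def by blast
  have "rev z = rev w @ a # rev h" "rev z = rev t @ a # rev w"
    by (subst th(2), simp) (subst th(1), simp)
  moreover have "x = [] \<or> y = []" if "rev z = x @ rev w @ y" for x y
  proof -
    have "z = rev y @ w @ rev x" using arg_cong[OF that, of rev] by simp
    then show ?thesis using assms unfolding complete_return_def by (metis rev_is_Nil_conv)
  qed
  ultimately show ?thesis using assms unfolding complete_return_def by blast
qed

lemma complete_return_last:
  assumes "complete_return F w a (g @ w)" shows "\<exists>h. g = h @ [a]"
proof -
  obtain h where "g @ w = (h @ [a]) @ w" using assms unfolding complete_return_def by auto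
  then show ?thesis by simp
qed

context AR_language
begin

lemma AR_language_rev: "AR_language k (rev ` F)"
proof
  show "k \<ge> 2" by (rule k2)
  show "set u \<subseteq> {1..k}" if "u \<in> rev ` F" for u using letters that by fastforce
  show "u \<in> rev ` F" if "x @ u @ y \<in> rev ` F" for x u y
    using that factorial[of "rev y" "rev u" "rev x"] by (simp add: mem_rev_image)
  show "\<exists>c. u @ [c] \<in> rev ` F" if "u \<in> rev ` F" for u
    using that extend_left by (auto simp: mem_rev_image)
  show "\<exists>c. c # u \<in> rev ` F" if "u \<in> rev ` F" for u
    using that extend_right by (auto simp: mem_rev_image)
  show "\<exists>N. \<forall>v\<in>rev ` F. N \<le> length v \<longrightarrow> (\<exists>x y. v = x @ u @ y)" if "u \<in> rev ` F" for u
  proof -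
    have "rev u \<in> F" using that by (simp add: mem_rev_image)
    then obtain N where N: "\<forall>v\<in>F. N \<le> length v \<longrightarrow> (\<exists>x y. v = x @ rev u @ y)"
      using recurrent by blast
    have "\<exists>x y. v = x @ u @ y" if v: "v \<in> rev ` F" "N \<le> length v" for v
    proof -
      obtain x y where "rev v = x @ rev u @ y" using N v by (auto simp: mem_rev_image)
      from arg_cong[OF this, of rev] have "v = rev y @ u @ rev x" by simp
      then show ?thesis by blast
    qed
    then show ?thesis by blast
  qed
  show "\<exists>u. length u = n \<and> right_special (rev ` F) u" for n
    using left_special_exists[of n] by (metis length_rev right_special_rev)
  show "\<exists>u. length u = n \<and> left_special (rev ` F) u" for n
    using right_special_exists[of n] by (metis length_rev left_special_rev)
  show "u = v" if "right_special (rev ` F) u" "right_special (rev ` F) v" "length u = length v" for u v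
    using that left_special_unique[of "rev u" "rev v"] right_special_rev[of F "rev u"]
      right_special_rev[of F "rev v"] by simp
  show "u = v" if "left_special (rev ` F) u" "left_special (rev ` F) v" "length u = length v" for u v
    using that right_special_unique[of "rev u" "rev v"] left_special_rev[of F "rev u"]
      left_special_rev[of F "rev v"] by simp
  show "u @ [c] \<in> rev ` F" if "right_special (rev ` F) u" "c \<in> {1..k}" for u c
    using that left_special_full[of "rev u" c] right_special_rev[of F "rev u"]
    by (simp add: mem_rev_image)
  show "c # u \<in> rev ` F" if "left_special (rev ` F) u" "c \<in> {1..k}" for u c
    using that right_special_full[of "rev u" c] left_special_rev[of F "rev u"]
    by (simp add: mem_rev_image)
qed

lemma prefix_in: "x @ y \<in> F \<Longrightarrow> x \<in> F"
  using factorial[of "[]" x y] by simp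

lemma suffix_in: "x @ y \<in> F \<Longrightarrow> y \<in> F"
  using factorial[of x y "[]"] by simp

lemma right_special_suffix: "right_special F (x @ u) \<Longrightarrow> right_special F u"
  unfolding right_special_def by (metis append_assoc suffix_in)

lemma left_special_prefix: "left_special F (u @ x) \<Longrightarrow> left_special F u"
  unfolding left_special_def by (metis append_Cons prefix_in)

lemma right_special_letter:
  assumes "right_special F w" shows "\<exists>!i. right_special F (i # w)"
proof -
  obtain v where v: "length v = Suc (length w)" "right_special F v"
    using right_special_exists by blast
  then obtain i u where u: "v = i # u" by (cases v) auto
  then have "right_special F u" using v right_special_suffix[of "[i]" u] by simp
  then have "u = w" using right_special_unique assms u v by simp
  then have "right_special F (i # w)" using u v by simp
  moreover have "j = i" if "right_special F (j # w)" for j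
    using right_special_unique[OF that \<open>right_special F (i # w)\<close>] by simp
  ultimately show ?thesis by blast
qed

lemma extend_right_long:
  assumes "u \<in> F" shows "\<exists>y. u @ y \<in> F \<and> n \<le> length y"
proof (induction n)
  case (Suc n)
  then obtain y where "u @ y \<in> F" "n \<le> length y" by blast
  then show ?case using extend_right[of "u @ y"] by (metis append_assoc length_append_singleton Suc_le_mono)
qed (use assms in \<open>auto intro!: exI[of _ "[]"]\<close>)

text \<open>Two words in \<open>F\<close> can part only after a right-special word. Were the longest common prefix of
  the two words a proper prefix of \<open>z\<close>, its suffix of length \<open>|w|\<close> would be right-special, hence equal
  to \<open>w\<close>, which cannot occur in the interior of \<open>z\<close>.\<close>

lemma complete_return_prefix:
  assumes z: "complete_return F w a z" and w: "right_special F w"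
    and v: "w @ a # t \<in> F" "length z \<le> length (w @ a # t)"
  shows "\<exists>y. w @ a # t = z @ y"
proof -
  obtain s where s: "z = w @ a # s" using z by (auto simp: complete_return_def)
  have "take m s = take m t" if "m \<le> length s" for m
    using that
  proof (induction m)
    case (Suc m)
    then have m: "m < length s" "m < length t" "take m s = take m t" using v s by auto
    let ?q = "w @ a # take m s"
    have ss: "z = ?q @ [s ! m] @ drop (Suc m) s" using s by (simp add: Cons_nth_drop_Suc m(1))
    have tt: "w @ a # t = ?q @ [t ! m] @ drop (Suc m) t"
      unfolding m(3) by (simp add: Cons_nth_drop_Suc m(2))
    have "s ! m = t ! m"
    proof (rule ccontr)
      assume ne: "s ! m \<noteq> t ! m"
      have "?q @ [s ! m] \<in> F" using z ss prefix_in unfolding complete_return_def by (metis append_assoc)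
      moreover have "?q @ [t ! m] \<in> F" using v(1) tt prefix_in by (metis append_assoc)
      ultimately have q: "right_special F ?q"
        unfolding right_special_def using ne prefix_in by blast
      \<comment> \<open>the occurrence of \<open>w\<close> that ends where the two words part\<close>
      define p where "p = take (length ?q - length w) ?q"
      define r where "r = drop (length ?q - length w) ?q"
      have pr: "?q = p @ r" by (simp only: p_def r_def append_take_drop_id)
      have "length r = length w" by (simp add: r_def)
      then have "r = w" using right_special_unique w q right_special_suffix[of p r] pr by metis
      then have "z = p @ w @ (s ! m # drop (Suc m) s)" using ss pr by simp
      then have "p = []" using z unfolding complete_return_def by blast
      then show False by (auto simp: p_def)
    qed
    then show ?case using m by (simp add: take_Suc_conv_app_nth)
  qed simp
  from this[of "length s"] have "s = take (length s) t" by simp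
  then have "t = s @ drop (length s) t" by (metis append_take_drop_id)
  then show ?thesis using s by (metis append_Cons append_assoc)
qed

lemma follow_return_right:
  assumes z: "complete_return F w a z" and w: "right_special F w" and v: "x @ w @ [a] \<in> F"
  shows "x @ z \<in> F"
proof -
  obtain y where y: "(x @ w @ [a]) @ y \<in> F" "length z \<le> length y" using extend_right_long[OF v] by blast
  then have in_F: "x @ (w @ a # y) \<in> F" by simp
  then obtain y' where "w @ a # y = z @ y'"
    using complete_return_prefix[OF z w suffix_in[OF in_F]] y(2) by auto
  then have "(x @ z) @ y' \<in> F" using in_F by simp
  then show ?thesis by (rule prefix_in)
qed

lemma follow_return_left:
  assumes z: "complete_return F w a z" and w: "left_special F w" and v: "a # w @ y \<in> F"
  shows "z @ y \<in> F"
proof -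
  have "rev y @ rev z \<in> rev ` F"
    by (rule AR_language.follow_return_right[OF AR_language_rev complete_return_rev[OF z]])
      (use w v in \<open>simp_all add: right_special_rev mem_rev_image\<close>)
  then show ?thesis by (simp add: mem_rev_image)
qed

end

text \<open>An occurrence of \<open>w\<close> at a position strictly between \<open>0\<close> and \<open>|g|\<close> would end inside
  \<open>g @ w\<close>, whatever follows there.\<close>

lemma complete_return_occurrence:
  assumes z: "complete_return F w a (g @ w)" and eq: "g @ w @ r = x @ w @ s"
    and x: "x \<noteq> []"
  shows "length g \<le> length x"
proof (rule ccontr)
  assume "\<not> length g \<le> length x"
  then obtain e where e: "g = x @ e" "e \<noteq> []"
    using eq by (auto simp: append_eq_append_conv2)
  then have "e @ w @ r = w @ s" using eq by simp
  then have "take (length w) (e @ w @ r) = w" by simp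
  moreover have "take (length w) (e @ w @ r) = take (length w) (e @ w)" by simp
  ultimately have "e @ w = w @ drop (length w) (e @ w)" by (metis append_take_drop_id)
  moreover define y where "y = drop (length w) (e @ w)"
  ultimately have "e @ w = w @ y" "y \<noteq> []" using e(2) by auto
  then have "g @ w = x @ w @ y" "y \<noteq> []" using e by auto
  then show False using z x unfolding complete_return_def by blast
qed

section \<open>Passing from one bispecial word to the next\<close>

context AR_language
begin

text \<open>Each \<open>u a\<close> is the return word of the bispecial word \<open>w\<close> for the letter \<open>a\<close>, so a long factor is cut at
  the occurrences of \<open>w\<close> into words \<open>u a\<close>. Since \<open>u a\<close> ends with \<open>a\<close>, the letters after the
  occurrences of \<open>w\<close> and those before the respective next occurrences form the same sequence.\<close>

definition return_system :: "nat list \<Rightarrow> (nat \<Rightarrow> nat list) \<Rightarrow> bool" where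
  "return_system w u \<longleftrightarrow> left_special F w \<and> right_special F w \<and>
     (\<forall>a\<in>{1..k}. complete_return F w a (u a @ w))"

definition special_letter :: "nat list \<Rightarrow> nat" where
  "special_letter w = (THE i. right_special F (i # w))"

lemma special_letter_eq: "right_special F (i # w) \<Longrightarrow> special_letter w = i"
  unfolding special_letter_def
  using right_special_letter[of w] right_special_suffix[of "[i]" w] by auto

lemma right_special_special_letter:
  assumes "right_special F w" shows "right_special F (special_letter w # w)"
  using right_special_letter[OF assms] special_letter_eq by blast

lemma letter_in: "x @ a # y \<in> F \<Longrightarrow> a \<in> {1..k}"
  using letters[of "x @ a # y"] by simp

lemma another_letter: "\<exists>b\<in>{1..k}. b \<noteq> a"
proof -
  have "1 \<in> {1..k}" "2 \<in> {1..k}" using k2 by auto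
  then show ?thesis by (metis one_eq_numeral_iff num.distinct(1))
qed

lemma left_special_letter:
  assumes w: "left_special F w" shows "\<exists>j. left_special F (w @ [j])"
proof -
  have "right_special (rev ` F) (rev w)" using w by (simp add: right_special_rev)
  then obtain j where "right_special (rev ` F) (j # rev w)"
    using AR_language.right_special_letter[OF AR_language_rev] by blast
  then have "left_special F (w @ [j])" using right_special_rev[of F "w @ [j]"] by simp
  then show ?thesis by blast
qed

text \<open>Let \<open>i\<close> be the special letter and \<open>w @ [j]\<close> left-special. An occurrence of \<open>w\<close> preceded by
  \<open>c \<noteq> i\<close> must be followed by \<open>j\<close>, since \<open>c # w\<close> is not right-special and extends by \<open>j\<close>. The return
  word for \<open>j\<close> ends with \<open>j\<close>. So if \<open>j \<noteq> i\<close>, then an occurrence of \<open>w @ [j]\<close> forces \<open>j\<close> after every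
  later occurrence of \<open>w\<close>, which contradicts the recurrence of \<open>w @ [b]\<close> for another letter \<open>b\<close>.\<close>

lemma left_special_special_letter:
  assumes sys: "return_system w u"
  shows "left_special F (w @ [special_letter w])"
proof -
  let ?i = "special_letter w"
  have w: "left_special F w" "right_special F w"
    and u: "\<And>a. a \<in> {1..k} \<Longrightarrow> complete_return F w a (u a @ w)"
    using sys by (auto simp: return_system_def)
  obtain j where j: "left_special F (w @ [j])" using left_special_letter[OF w(1)] by blast
  have jA: "j \<in> {1..k}" using j letter_in[of w j "[]"] by (simp add: left_special_def)
  have after: "d = j" if "c # w @ [d] \<in> F" "c \<noteq> ?i" for c d
  proof (rule ccontr)
    assume "d \<noteq> j"
    have "c \<in> {1..k}" using that(1) letter_in[of "[]" c] by simp
    then have "(c # w) @ [j] \<in> F" using left_special_full[OF j] by simp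
    moreover have "c # w \<in> F" using that(1) prefix_in[of "c # w" "[d]"] by simp
    ultimately have "right_special F (c # w)"
      using that(1) \<open>d \<noteq> j\<close> unfolding right_special_def by (metis append_Cons)
    then show False using special_letter_eq that(2) by blast
  qed
  have "j = ?i"
  proof (rule ccontr)
    assume ne: "j \<noteq> ?i"
    have z: "complete_return F w j (u j @ w)" using u[OF jA] .
    obtain h where h: "u j = h @ [j]" using complete_return_last[OF z] by blast
    \<comment> \<open>induction over the occurrences of \<open>w\<close>, by cutting off one return word \<open>u j\<close>\<close>
    have only: "a = j" if "w @ j # y \<in> F" "w @ j # y = x @ w @ [a]" for x y a
      using that
    proof (induction "length x" arbitrary: x y rule: less_induct)
      case less
      show ?case
      proof (cases "x = []")
        case False
        have len: "length (u j @ w) \<le> length (w @ j # y)"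
        proof (rule ccontr)
          assume short: "\<not> length (u j @ w) \<le> length (w @ j # y)"
          obtain e where e: "(w @ j # y) @ e \<in> F" "length (u j @ w) \<le> length e"
            using extend_right_long[OF less.prems(1)] by blast
          then obtain f where "w @ j # (y @ e) = (u j @ w) @ f"
            using complete_return_prefix[OF z w(2), of "y @ e"] by auto
          then have "u j @ w @ f = x @ w @ (a # e)" using less.prems(2)
            by (metis append_Cons append_assoc append_Nil)
          then have "length (u j) \<le> length x" by (rule complete_return_occurrence[OF z _ False])
          then show False using short less.prems(2) by simp
        qed
        obtain f where f: "w @ j # y = (u j @ w) @ f"
          using complete_return_prefix[OF z w(2) less.prems(1) len] by blast
        have eq: "u j @ w @ f = x @ w @ [a]" using f less.prems(2) by simp
        have lx: "length (u j) \<le> length x" by (rule complete_return_occurrence[OF z eq False])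
        have "length (u j) + length f = length x + 1" using arg_cong[OF eq, of length] by simp
        then have "length f > 0" using lx by linarith
        then obtain b f' where b: "f = b # f'" by (cases f) auto
        have "h @ (j # w @ [b]) @ f' \<in> F" using less.prems(1) f h b by simp
        then have "j # w @ [b] \<in> F" by (rule factorial)
        then have "b = j" using after ne by blast
        define x' where "x' = drop (length (u j)) x"
        have x: "x = u j @ x'"
        proof -
          have "take (length (u j)) (x @ w @ [a]) = u j" unfolding eq[symmetric] by simp
          then show ?thesis using lx unfolding x'_def by (simp) (metis append_take_drop_id)
        qed
        have eq': "w @ j # f' = x' @ w @ [a]" using eq x b \<open>b = j\<close> by simp
        have "w @ j # f' \<in> F" using less.prems(1) f b \<open>b = j\<close> suffix_in[of "u j" "w @ j # f'"] by simp
        moreover have "length x' < length x" using x h by simp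
        ultimately show ?thesis using less.hyps eq' by blast
      qed (use less.prems in simp)
    qed
    obtain b where b: "b \<in> {1..k}" "b \<noteq> j" using another_letter by blast
    have "w @ [b] \<in> F" using right_special_full[OF w(2) b(1)] .
    then obtain N where N: "\<And>v. v \<in> F \<Longrightarrow> N \<le> length v \<Longrightarrow> \<exists>x y. v = x @ (w @ [b]) @ y"
      using recurrent by blast
    have "w @ [j] \<in> F" using j by (simp add: left_special_def)
    then obtain y where y: "(w @ [j]) @ y \<in> F" "N \<le> length y" using extend_right_long by blast
    then obtain p q where pq: "(w @ [j]) @ y = p @ (w @ [b]) @ q" using N[of "(w @ [j]) @ y"] by auto
    define v where "v = take (length (p @ w @ [b])) ((w @ [j]) @ y)"
    have v: "v = p @ w @ [b]" unfolding v_def pq by simp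
    have "v \<in> F" using prefix_in[of v q] y(1) pq v by simp
    moreover have "v = w @ j # take (length p) y" unfolding v_def by simp
    ultimately show False using only[of "take (length p) y" p b] v b(2) by metis
  qed
  then show ?thesis using j by simp
qed

definition next_word :: "nat list \<Rightarrow> (nat \<Rightarrow> nat list) \<Rightarrow> nat list" where
  "next_word w u = u (special_letter w) @ w"

definition next_returns :: "nat list \<Rightarrow> (nat \<Rightarrow> nat list) \<Rightarrow> nat \<Rightarrow> nat list" where
  "next_returns w u a =
     (if a = special_letter w then u a else u (special_letter w) @ u a)"

lemma return_system_Nil: "return_system [] (\<lambda>a. [a])"
proof -
  have nil: "left_special F []" "right_special F []"
    using left_special_exists[of 0] right_special_exists[of 0] by auto
  have "complete_return F [] a [a]" if "a \<in> {1..k}" for a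
    using right_special_full[OF nil(2) that] by (auto simp: complete_return_def Cons_eq_append_conv)
  then show ?thesis using nil by (auto simp: return_system_def)
qed

text \<open>Follow the sequence from one occurrence of \<open>w\<close> to the next. Since \<open>w @ [i]\<close> is left-special and
  \<open>i # w\<close> is right-special, the forced continuation \<open>u i @ w\<close> is special on both sides. After the
  letter \<open>a \<noteq> i\<close> the next letter read at an occurrence of \<open>w\<close> is \<open>i\<close>. So \<open>u i @ w\<close>
  followed by \<open>a\<close> returns to itself through \<open>u i @ u a @ u i @ w\<close>, while followed by \<open>i\<close> it returns
  through \<open>u i @ u i @ w\<close>. No return is earlier, because each occurrence of \<open>u i @ w\<close> begins with an
  occurrence of \<open>w @ [i]\<close>.\<close>

lemma return_system_next:
  assumes sys: "return_system w u"
  shows "return_system (next_word w u) (next_returns w u)"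
proof -
  define i where "i = special_letter w"
  have w: "left_special F w" "right_special F w"
    and z: "\<And>a. a \<in> {1..k} \<Longrightarrow> complete_return F w a (u a @ w)"
    using sys by (auto simp: return_system_def)
  have u: "\<exists>h. u a = h @ [a]" if "a \<in> {1..k}" for a using complete_return_last[OF z[OF that]] .
  have iw: "right_special F (i # w)"
    unfolding i_def by (rule right_special_special_letter[OF w(2)])
  have wi: "left_special F (w @ [i])"
    unfolding i_def by (rule left_special_special_letter[OF sys])
  have iA: "i \<in> {1..k}" using wi letter_in[of w i "[]"] by (simp add: left_special_def)
  define w' where "w' = u i @ w"
  obtain t where t: "w' = w @ i # t" using z[OF iA] by (auto simp: complete_return_def w'_def)
  obtain h where h: "u i = h @ [i]" using u[OF iA] by blast
  note right = follow_return_right[OF z w(2)]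
  have cw': "c # w' \<in> F" if "c \<in> {1..k}" for c
    using right[OF iA, of "[c]"] left_special_full[OF wi that] by (simp add: w'_def)
  have w'c: "w' @ [c] \<in> F" if "c \<in> {1..k}" for c
    using follow_return_left[OF z[OF iA] w(1), of "[c]"] right_special_full[OF iw that]
    by (simp add: w'_def)
  have two: "(1::nat) \<in> {1..k}" "2 \<in> {1..k}" "(1::nat) \<noteq> 2" using k2 by auto
  have w'_in: "w' \<in> F" using cw'[OF two(1)] suffix_in[of "[1]" w'] by simp
  have special: "left_special F w'" "right_special F w'"
    unfolding left_special_def right_special_def using cw' w'c two w'_in by blast+
  have "complete_return F w' a (next_returns w u a @ w')"
    if a: "a \<in> {1..k}" for a
  proof (cases "a = i")
    case True
    have "u i @ w @ [i] \<in> F" using w'c[OF iA] by (simp add: w'_def)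
    then have "u i @ w' \<in> F" unfolding w'_def by (rule right[OF iA])
    moreover have "u i @ w' = w' @ i # t" using t by (simp add: w'_def)
    moreover have "u i @ w' = h @ i # w'" using h by simp
    moreover have "x = [] \<or> y = []" if eq: "u i @ w' = x @ w' @ y" for x y
    proof (cases "x = []")
      case False
      have "u i @ w @ (i # t) = x @ w @ (i # t @ y)" using eq t w'_def by simp
      then have "length (u i) \<le> length x" by (rule complete_return_occurrence[OF z[OF iA] _ False])
      then show ?thesis using arg_cong[OF eq, of length] by simp
    qed simp
    ultimately have "complete_return F w' i (u i @ w')" unfolding complete_return_def by blast
    then show ?thesis using True by (simp add: next_returns_def i_def[symmetric])
  next
    case False
    obtain g where g: "u a = g @ [a]" using u[OF a] by blast
    obtain s where s: "u a @ w = w @ a # s" using z[OF a] by (auto simp: complete_return_def)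
    have "u i @ w @ [a] \<in> F" using w'c[OF a] by (simp add: w'_def)
    then have "u i @ u a @ w \<in> F" by (rule right[OF a])
    then obtain c where "(u i @ u a @ w) @ [c] \<in> F" using extend_right by blast
    then have c: "(u i @ g) @ (a # w @ [c]) \<in> F" by (simp add: g)
    have "c = i"
    proof (rule ccontr)
      assume "c \<noteq> i"
      have ac: "(a # w) @ [c] \<in> F" using suffix_in[OF c] by simp
      moreover have "(a # w) @ [i] \<in> F" using left_special_full[OF wi a] by simp
      ultimately have "right_special F (a # w)"
        using \<open>c \<noteq> i\<close> prefix_in[OF ac] unfolding right_special_def by blast
      then show False using special_letter_eq False i_def by blast
    qed
    then have "(u i @ u a) @ w @ [i] \<in> F" using c by (simp add: g)
    then have "(u i @ u a) @ w' \<in> F" unfolding w'_def by (rule right[OF iA])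
    moreover have uaw': "u a @ w' = w @ a # (s @ i # t)"
    proof -
      have "u a @ w' = (u a @ w) @ i # t" by (simp add: t)
      then show ?thesis unfolding s by simp
    qed
    then have "(u i @ u a) @ w' = w' @ a # (s @ i # t)" by (simp add: w'_def)
    moreover have "(u i @ u a) @ w' = (u i @ g) @ a # w'" by (simp add: g)
    moreover have "x = [] \<or> y = []" if eq: "(u i @ u a) @ w' = x @ w' @ y" for x y
    proof (cases "x = []")
      case False
      have "u i @ w @ (a # s @ i # t) = x @ w @ (i # t @ y)" using eq[unfolded append_assoc uaw'] by (simp add: t)
      then have len: "length (u i) \<le> length x" by (rule complete_return_occurrence[OF z[OF iA] _ False])
      define x' where "x' = drop (length (u i)) x"
      have "take (length (u i)) (x @ w' @ y) = u i" unfolding eq[symmetric] by simp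
      then have x: "x = u i @ x'" using len unfolding x'_def by simp (metis append_take_drop_id)
      have eq': "u a @ w @ (i # t) = x' @ w @ (i # t @ y)" using eq x t by simp
      \<comment> \<open>at this place \<open>w\<close> is followed by \<open>a\<close>, but \<open>w'\<close> starts with \<open>w @ [i]\<close>\<close>
      have "x' \<noteq> []"
      proof
        assume "x' = []"
        then have "w @ a # s @ i # t = w @ (i # t @ y)" using uaw' eq' by (simp add: t)
        then show False using \<open>a \<noteq> i\<close> by simp
      qed
      then have "length (u a) \<le> length x'" by (rule complete_return_occurrence[OF z[OF a] eq'])
      then show ?thesis using arg_cong[OF eq', of length] by simp
    qed simp
    ultimately have "complete_return F w' a ((u i @ u a) @ w')" unfolding complete_return_def by blast
    then show ?thesis using False by (simp add: next_returns_def i_def[symmetric])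
  qed
  then show ?thesis using special unfolding return_system_def next_word_def w'_def i_def by blast
qed

text \<open>A longer bispecial word starts with \<open>w @ [i]\<close> and ends with \<open>w\<close>, by uniqueness of special words of
  each length, so it reaches at least to the first return of \<open>w\<close>.\<close>

lemma bispecial_next:
  assumes sys: "return_system w u" and v: "left_special F v" "right_special F v"
    and len: "length w < length v"
  shows "length (next_word w u) \<le> length v"
proof -
  let ?i = "special_letter w"
  have w: "left_special F w" "right_special F w"
    and z: "\<And>a. a \<in> {1..k} \<Longrightarrow> complete_return F w a (u a @ w)"
    using sys by (auto simp: return_system_def)
  have wi: "left_special F (w @ [?i])" by (rule left_special_special_letter[OF sys])
  then have iA: "?i \<in> {1..k}" using letter_in[of w ?i "[]"] by (simp add: left_special_def)
  define p where "p = take (length w + 1) v"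
  define q where "q = drop (length w + 1) v"
  define r where "r = take (length v - length w) v"
  define s where "s = drop (length v - length w) v"
  have pq: "v = p @ q" and rs: "v = r @ s" by (simp_all add: p_def q_def r_def s_def)
  have "p = w @ [?i]"
  proof (rule left_special_unique[OF _ wi])
    have "left_special F (p @ q)" using v(1) pq by metis
    then show "left_special F p" by (rule left_special_prefix)
  qed (use len in \<open>simp add: p_def\<close>)
  moreover have "s = w"
  proof (rule right_special_unique[OF _ w(2)])
    have "right_special F (r @ s)" using v(2) rs by metis
    then show "right_special F s" by (rule right_special_suffix)
  qed (use len in \<open>simp add: s_def\<close>)
  ultimately have v1: "v = w @ ?i # q" and v2: "v = r @ w" using pq rs by simp_all
  have vF: "v \<in> F" using v by (simp add: right_special_def)
  obtain e where e: "v @ e \<in> F" "length (u ?i @ w) \<le> length e" using extend_right_long[OF vF] by blast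
  have "w @ ?i # (q @ e) \<in> F" using e v1 by simp
  moreover have "length (u ?i @ w) \<le> length (w @ ?i # (q @ e))" using e(2) by simp
  ultimately obtain f where "w @ ?i # (q @ e) = (u ?i @ w) @ f"
    using complete_return_prefix[OF z[OF iA] w(2)] by blast
  then have "u ?i @ w @ f = r @ w @ e" using v1 v2 by (metis append.assoc append_Cons)
  moreover have "r \<noteq> []" using v2 len by auto
  ultimately have "length (u ?i) \<le> length r" by (rule complete_return_occurrence[OF z[OF iA]])
  then show ?thesis using v2 by (simp add: next_word_def)
qed

end

section \<open>Runs of the index sequence and exponents\<close>

text \<open>The recursion for the lengths \<open>W n\<close> of the bispecial words and \<open>d n a\<close> of their return words.
  The numbering is shifted: \<open>W n\<close> belongs to the bispecial word with index \<open>n + 1\<close>, whereas \<open>I\<close> is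
  indexed from \<open>1\<close>; hence \<open>I (Suc n)\<close> leads from \<open>n\<close> to \<open>n + 1\<close>.\<close>

locale return_lengths =
  fixes I :: "nat \<Rightarrow> nat" and W :: "nat \<Rightarrow> nat" and d :: "nat \<Rightarrow> nat \<Rightarrow> nat"
  assumes W_0: "W 0 = 0" and d_0: "d 0 a = 1"
    and W_Suc: "W (Suc n) = W n + d n (I (Suc n))"
    and d_Suc: "d (Suc n) a = (if a = I (Suc n) then d n a else d n a + d n (I (Suc n)))"
begin

lemma d_pos: "d n a > 0"
  by (induction n) (auto simp: d_0 d_Suc)

text \<open>With only the two letters \<open>a\<close> and \<open>b\<close> this is an equality, the classical relation between the two
  periods of a central word; reading a third letter adds more to the right-hand side.\<close>

lemma sum_return_lengths: "a \<noteq> b \<Longrightarrow> W n + 2 \<le> d n a + d n b"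
proof (induction n)
  case (Suc n)
  then show ?case using d_pos[of n "I (Suc n)"] by (auto simp: W_Suc d_Suc)
qed (simp add: W_0 d_0)

lemma return_length_fresh: "(\<And>m. 1 \<le> m \<Longrightarrow> m \<le> n \<Longrightarrow> I m \<noteq> a) \<Longrightarrow> d n a = W n + 1"
proof (induction n)
  case (Suc n)
  then have "d n a = W n + 1" "I (Suc n) \<noteq> a" by auto
  then show ?case by (auto simp: W_Suc d_Suc)
qed (simp add: W_0 d_0)

lemma return_length_seen: "1 \<le> m \<Longrightarrow> m \<le> n \<Longrightarrow> I m = a \<Longrightarrow> d n a \<le> W n"
proof (induction n)
  case (Suc n)
  show ?case
  proof (cases "m = Suc n")
    case False
    then have "d n a \<le> W n" using Suc by simp
    then show ?thesis by (simp add: W_Suc d_Suc)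
  qed (use Suc in \<open>simp add: W_Suc d_Suc\<close>)
qed simp

lemma return_length_run:
  "(\<And>m. n < m \<Longrightarrow> m \<le> n + r \<Longrightarrow> I m = a) \<Longrightarrow> d (n + r) a = d n a \<and> W (n + r) = W n + r * d n a"
proof (induction r)
  case (Suc r)
  then have "I (Suc (n + r)) = a" "d (n + r) a = d n a" "W (n + r) = W n + r * d n a" by auto
  then show ?case by (simp add: W_Suc d_Suc)
qed simp

lemma exponent_run:
  assumes "\<And>m. n < m \<Longrightarrow> m \<le> n + r \<Longrightarrow> I m = a"
  shows "W (n + r) div d (n + r) a = r + W n div d n a"
  using return_length_run[of n r a] assms d_pos[of n a] by simp

text \<open>If \<open>b = I n \<noteq> a\<close> has just been read, then \<open>d n a > d n b\<close>, so the bound on \<open>d n a + d n b\<close> gives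
  \<open>W n < 2 * d n a\<close>.\<close>

lemma exponent_before_run:
  assumes "n = 0 \<or> I n \<noteq> a"
  shows "W n div d n a = (if \<exists>m. 1 \<le> m \<and> m \<le> n \<and> I m = a then 1 else 0)"
proof (cases "\<exists>m. 1 \<le> m \<and> m \<le> n \<and> I m = a")
  case True
  then have le: "d n a \<le> W n" using return_length_seen by blast
  from True obtain p where p: "n = Suc p" by (cases n) auto
  then have ne: "I n \<noteq> a" using assms by simp
  have "W n < 2 * d n a"
    using sum_return_lengths[OF ne, of n] p ne d_pos[of p a] by (auto simp: d_Suc)
  then have "W n div d n a = 1" using le by (intro div_nat_eqI) auto
  then show ?thesis using True by simp
next
  case False
  then have "d n a = W n + 1" using return_length_fresh by blast
  then show ?thesis using False by auto
qed

lemma run_start: "\<exists>s\<le>n. (\<forall>m. s < m \<and> m \<le> n \<longrightarrow> I m = a) \<and> (s = 0 \<or> I s \<noteq> a)"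
proof (induction n)
  case (Suc n)
  then obtain s where s: "s \<le> n" "\<forall>m. s < m \<and> m \<le> n \<longrightarrow> I m = a" "s = 0 \<or> I s \<noteq> a" by blast
  show ?case
  proof (cases "I (Suc n) = a")
    case True
    then have "\<forall>m. s < m \<and> m \<le> Suc n \<longrightarrow> I m = a" using s(2) by (auto simp: le_Suc_eq)
    then show ?thesis using s by (intro exI[of _ s]) auto
  qed (intro exI[of _ "Suc n"], simp)
qed simp

text \<open>For the upper bound, \<open>n\<close> and \<open>a\<close> are attributed to the run of \<open>a\<close> that ends at \<open>n\<close> and is maximal to
  the left; without such a run the exponent is at most \<open>2\<close>, which the open run at position \<open>1\<close>
  supplies. For the lower bound, a closed run that is not maximal to the left starts with a quotient
  that is at least as large.\<close>

lemma Sup_exponents: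
  assumes I: "\<And>m. 1 \<le> m \<Longrightarrow> I m \<in> {1..k}"
  shows "Sup {enat (1 + W n div d n a) | n a. a \<in> {1..k}} = max (N1 k I) (N2 k I)"
    (is "?S = _")
proof (rule antisym)
  have open_le: "enat r + 1 \<le> N1 k I" if "r \<ge> 1" "open_run k I r a l" for r a l
  proof -
    have "enat r \<le> Sup {enat r |r. r \<ge> 1 \<and> (\<exists>a l. open_run k I r a l)}"
      using that by (intro Sup_upper) auto
    from add_left_mono[OF this, of 1] show ?thesis by (simp add: N1_def add.commute)
  qed
  have closed_le: "enat r + 2 \<le> N2 k I" if "r \<ge> 1" "closed_run k I r a l" for r a l
  proof -
    have "enat r \<le> Sup {enat r |r. r \<ge> 1 \<and> (\<exists>a l. closed_run k I r a l)}"
      using that by (intro Sup_upper) auto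
    from add_left_mono[OF this, of 2] show ?thesis by (simp add: N2_def add.commute)
  qed
  have first: "open_run k I 1 (I 1) 1"
  proof -
    have run: "\<forall>m. 1 \<le> m \<and> m < 1 + 1 \<longrightarrow> I m = I 1"
    proof (intro allI impI)
      fix m :: nat assume "1 \<le> m \<and> m < 1 + 1"
      then have "m = 1" by simp
      then show "I m = I 1" by simp
    qed
    show ?thesis unfolding open_run_def run_def alphabet_def
      by (intro conjI run I) simp_all
  qed
  have two: "enat 2 \<le> N1 k I" using open_le[OF _ first] by (simp add: one_enat_def numeral_2_eq_2)
  show "?S \<le> max (N1 k I) (N2 k I)"
  proof (rule Sup_least)
    fix x assume "x \<in> {enat (1 + W n div d n a) | n a. a \<in> {1..k}}"
    then obtain n a where x: "x = enat (1 + W n div d n a)" and a: "a \<in> {1..k}" by blast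
    obtain s where s: "s \<le> n" "\<And>m. s < m \<Longrightarrow> m \<le> n \<Longrightarrow> I m = a" and start: "s = 0 \<or> I s \<noteq> a"
      using run_start[of n a] by blast
    define r where "r = n - s"
    have n: "n = s + r" using s by (simp add: r_def)
    define e where "e = W s div d s a"
    have W: "W n div d n a = r + e" using exponent_run[of s r a] s n by (simp add: e_def)
    have e: "e = (if \<exists>m. 1 \<le> m \<and> m \<le> s \<and> I m = a then 1 else 0)"
      unfolding e_def using start by (rule exponent_before_run)
    show "x \<le> max (N1 k I) (N2 k I)"
    proof (cases "r = 0")
      case True
      then have "x \<le> enat 2" using x W e by simp
      then show ?thesis using two by (meson max.coboundedI1 order_trans)
    next
      case False
      have run: "run k I r a (Suc s)" using s n a by (auto simp: run_def alphabet_def)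
      show ?thesis
      proof (cases "\<exists>m. 1 \<le> m \<and> m \<le> s \<and> I m = a")
        case True
        then have "closed_run k I r a (Suc s)" using run by (auto simp: closed_run_def open_run_def)
        then have "enat r + 2 \<le> N2 k I" using closed_le False by simp
        moreover have "x = enat r + 2" using x W e True by (simp add: numeral_eq_enat)
        ultimately show ?thesis by (simp add: le_max_iff_disj)
      next
        case nex: False
        then have "open_run k I r a (Suc s)" using run by (auto simp: open_run_def)
        then have "enat r + 1 \<le> N1 k I" using open_le False by simp
        moreover have "e = 0" using e nex by simp
        then have "x = enat r + 1" using x W by (simp add: one_enat_def)
        ultimately show ?thesis by (simp add: le_max_iff_disj)
      qed
    qed
  qed
  have upper: "enat (1 + W n div d n a) \<le> ?S" if "a \<in> {1..k}" for n a
    using that by (intro Sup_upper) auto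
  have run_le: "enat (1 + r + W (l - 1) div d (l - 1) a) \<le> ?S" if "run k I r a l" for r a l
  proof -
    have "W (l - 1 + r) div d (l - 1 + r) a = r + W (l - 1) div d (l - 1) a"
    proof (rule exponent_run)
      fix m assume "l - 1 < m" "m \<le> l - 1 + r"
      moreover have "1 \<le> l" using that by (simp add: run_def)
      ultimately have "l \<le> m \<and> m < l + r" by arith
      then show "I m = a" using that unfolding run_def by blast
    qed
    then show ?thesis using upper[of a "l - 1 + r"] that by (simp add: run_def alphabet_def)
  qed
  \<comment> \<open>the bound on \<open>c\<close> covers the case that there are no such \<open>r\<close>\<close>
  have add_Sup: "enat c + Sup {enat r |r. r \<ge> 1 \<and> Q r} \<le> ?S"
    if Q: "\<And>r. r \<ge> 1 \<Longrightarrow> Q r \<Longrightarrow> enat (c + r) \<le> ?S" and c: "enat c \<le> ?S" for c Q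
  proof (cases ?S)
    case (enat s)
    have "Sup {enat r |r. r \<ge> 1 \<and> Q r} \<le> enat (s - c)"
      by (rule Sup_least) (use Q enat in fastforce)
    then have "enat c + Sup {enat r |r. r \<ge> 1 \<and> Q r} \<le> enat c + enat (s - c)" by (rule add_left_mono)
    also have "\<dots> = enat s" using c enat by simp
    finally show ?thesis using enat by simp
  qed simp
  have oneS: "enat 1 \<le> ?S" and twoS: "enat 2 \<le> ?S"
    using run_le[of 1 "I 1" 1] first by (auto simp: open_run_def W_0 elim: order_trans[rotated])
  have "N1 k I \<le> ?S"
    unfolding N1_def one_enat_def
  proof (rule add_Sup[OF _ oneS])
    fix r assume "\<exists>a l. open_run k I r a l"
    then obtain a l where "run k I r a l" by (auto simp: open_run_def)
    from run_le[OF this] show "enat (1 + r) \<le> ?S" by (rule order_trans[rotated]) simp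
  qed
  moreover have "N2 k I \<le> ?S"
    unfolding N2_def numeral_eq_enat
  proof (rule add_Sup[OF _ twoS])
    fix r assume "\<exists>a l. closed_run k I r a l"
    then obtain a l m where run: "run k I r a l" and m: "1 \<le> m" "m < l" "I m = a"
      by (auto simp: closed_run_def open_run_def)
    then have "d (l - 1) a \<le> W (l - 1)" using return_length_seen[of m "l - 1" a] by auto
    then have "1 \<le> W (l - 1) div d (l - 1) a" using d_pos by (simp add: div_greater_zero_iff Suc_le_eq)
    with run_le[OF run] show "enat (2 + r) \<le> ?S" by (elim order_trans[rotated]) simp
  qed
  ultimately show "max (N1 k I) (N2 k I) \<le> ?S" by simp
qed

end

section \<open>The sequence of bispecial words\<close>

lemma enumerate_range_strict_mono:
  fixes f :: "nat \<Rightarrow> nat"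
  assumes f: "strict_mono f" shows "enumerate (range f) n = f n"
proof (induction n)
  case 0
  have "f 0 \<le> f n" for n using strict_mono_less_eq[OF f] by simp
  then have "(LEAST x. x \<in> range f) = f 0" by (intro Least_equality) auto
  then show ?case by (simp add: enumerate_0)
next
  case (Suc n)
  have "infinite (range f)" using finite_imageD strict_mono_imp_inj_on[OF f] by blast
  then have "enumerate (range f) (Suc n) = (LEAST s. s \<in> range f \<and> f n < s)"
    using enumerate_Suc'' Suc.IH by metis
  also have "\<dots> = f (Suc n)"
  proof (rule Least_equality)
    show "f (Suc n) \<le> y" if "y \<in> range f \<and> f n < y" for y
      using that strict_mono_less[OF f] strict_mono_less_eq[OF f] by auto
  qed (use strict_mono_less[OF f] in auto)
  finally show ?case .
qed

context AR_language
begin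

primrec bispecial_with_returns :: "nat \<Rightarrow> nat list \<times> (nat \<Rightarrow> nat list)" where
  "bispecial_with_returns 0 = ([], \<lambda>a. [a])"
| "bispecial_with_returns (Suc n) =
     (let (w, u) = bispecial_with_returns n in (next_word w u, next_returns w u))"

definition bisp :: "nat \<Rightarrow> nat list" where
  "bisp n = fst (bispecial_with_returns n)"

definition ret :: "nat \<Rightarrow> nat \<Rightarrow> nat list" where
  "ret n = snd (bispecial_with_returns n)"

lemma bisp_0: "bisp 0 = []" and ret_0: "ret 0 = (\<lambda>a. [a])"
  by (simp_all add: bisp_def ret_def)

lemma bisp_Suc: "bisp (Suc n) = next_word (bisp n) (ret n)"
  and ret_Suc: "ret (Suc n) = next_returns (bisp n) (ret n)"
  by (simp_all add: bisp_def ret_def case_prod_beta)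

lemma return_system_bisp: "return_system (bisp n) (ret n)"
  by (induction n)
    (simp_all only: bisp_0 ret_0 bisp_Suc ret_Suc return_system_Nil return_system_next)

text \<open>The index sequence of the subshift, see \<open>index_seq_eq\<close>; index \<open>1\<close> belongs to \<open>bisp 0\<close>.\<close>

definition directive :: "nat \<Rightarrow> nat" where
  "directive n = special_letter (bisp (n - 1))"

sublocale return_lengths directive "\<lambda>n. length (bisp n)" "\<lambda>n a. length (ret n a)"
  by unfold_locales
    (simp_all add: bisp_0 ret_0 bisp_Suc ret_Suc next_word_def next_returns_def directive_def)

lemma directive_letter: "directive n \<in> {1..k}"
proof -
  have "right_special F (directive n # bisp (n - 1))"
    unfolding directive_def using return_system_bisp
    by (intro right_special_special_letter) (auto simp: return_system_def)
  then show ?thesis using letter_in[of "[]" "directive n" "bisp (n - 1)"] by (simp add: right_special_def)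
qed

lemma strict_mono_bisp: "strict_mono (\<lambda>n. length (bisp n))"
  using d_pos by (simp add: strict_mono_Suc_iff W_Suc)

lemma bispecial_bisp: "bispecial F (bisp n)"
  using return_system_bisp by (auto simp: bispecial_def return_system_def)

lemma bispecial_unique: "bispecial F v \<Longrightarrow> bispecial F w \<Longrightarrow> length v = length w \<Longrightarrow> v = w"
  using left_special_unique by (simp add: bispecial_def)

text \<open>No bispecial word has a length strictly between those of two consecutive words \<open>bisp n\<close>.\<close>

lemma bispecial_eq_bisp:
  assumes v: "bispecial F v" shows "\<exists>n. v = bisp n"
proof -
  have "length v < length (bisp (Suc (length v)))"
    using strict_mono_imp_increasing[OF strict_mono_bisp, of "Suc (length v)"] by simp
  then have ex: "\<exists>m. length v < length (bisp m)" by blast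
  define m where "m = (LEAST m. length v < length (bisp m))"
  have m: "length v < length (bisp m)" unfolding m_def by (rule LeastI_ex[OF ex])
  then obtain n where n: "m = Suc n" by (cases m) (auto simp: bisp_0)
  then have le: "length (bisp n) \<le> length v"
    using not_less_Least[of n "\<lambda>m. length v < length (bisp m)"] by (simp add: m_def[symmetric])
  moreover have "\<not> length (bisp n) < length v"
    using bispecial_next[OF return_system_bisp, of v n] v m n by (auto simp: bispecial_def bisp_Suc)
  ultimately have "length v = length (bisp n)" by simp
  then show ?thesis using bispecial_unique[OF v bispecial_bisp] by blast
qed

lemma bispecial_word_eq:
  assumes "language X = F" shows "bispecial_word X n = bisp (n - 1)"
proof -
  have "length ` {u. bispecial F u} = range (\<lambda>n. length (bisp n))"
  proof (intro equalityI image_subsetI)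
    show "length v \<in> range (\<lambda>n. length (bisp n))" if "v \<in> {u. bispecial F u}" for v
      using bispecial_eq_bisp[of v] that by auto
  qed (use bispecial_bisp in auto)
  then have "enumerate (length ` {u. bispecial F u}) (n - 1) = length (bisp (n - 1))"
    using enumerate_range_strict_mono[OF strict_mono_bisp] by simp
  then show ?thesis unfolding bispecial_word_def assms
    using bispecial_bisp bispecial_unique by (intro the_equality) auto
qed

lemma index_seq_eq: "language X = F \<Longrightarrow> index_seq X = directive"
  by (rule ext) (simp add: index_seq_def bispecial_word_eq directive_def special_letter_def)

end

section \<open>Powers\<close>

lemma word_power_Suc: "word_power u (Suc p) = u @ word_power u p"
  by (simp add: word_power_def)

lemma word_power_Suc2: "word_power u (Suc p) = word_power u p @ u"
  by (induction p) (simp_all add: word_power_def)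

lemma length_word_power: "length (word_power u p) = p * length u"
  by (induction p) (simp_all add: word_power_def)

text \<open>By the equation, \<open>w\<close> starts with \<open>u\<close> as long as it is not shorter, and the rest of \<open>w\<close> satisfies
  the same equation.\<close>

lemma word_power_prefix:
  assumes "u @ w = w @ y" "p * length u \<le> length w"
  shows "\<exists>z. w = word_power u p @ z"
  using assms
proof (induction p arbitrary: w)
  case (Suc p)
  have "u = take (length u) (w @ y)" using Suc.prems(1)[symmetric] by simp
  then have "u = take (length u) w" using Suc.prems(2) by simp
  then obtain v where v: "w = u @ v" by (metis append_take_drop_id)
  have "u @ v = v @ y" using Suc.prems(1) unfolding v by simp
  moreover have "p * length u \<le> length v" using Suc.prems(2) unfolding v by simp
  ultimately obtain z where "v = word_power u p @ z" using Suc.IH by blast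
  then show ?case using v by (simp add: word_power_Suc)
qed (simp add: word_power_def)

context AR_language
begin

text \<open>In a word of period \<open>q\<close> the letter after a factor \<open>v\<close> of length \<open>q\<close> is the first letter of \<open>v\<close>.
  For right-special \<open>v\<close> a long word contains \<open>v\<close> with two different letters after it.\<close>

lemma period_bounded:
  assumes "q \<ge> 1"
  shows "\<exists>B. \<forall>w g h. length g = q \<longrightarrow> g @ w \<in> F \<longrightarrow> g @ w = w @ h \<longrightarrow> length w < B"
proof -
  obtain v where v: "length v = q" "right_special F v" using right_special_exists by blast
  then obtain c d where cd: "c \<noteq> d" "v @ [c] \<in> F" "v @ [d] \<in> F" by (auto simp: right_special_def)
  obtain M where M: "\<forall>z\<in>F. M \<le> length z \<longrightarrow> (\<exists>x y. z = x @ (v @ [c]) @ y)"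
    using recurrent[OF cd(2)] by blast
  obtain N where N: "\<forall>z\<in>F. N \<le> length z \<longrightarrow> (\<exists>x y. z = x @ (v @ [d]) @ y)"
    using recurrent[OF cd(3)] by blast
  have "length w < M + N" if g: "length g = q" "g @ w \<in> F" "g @ w = w @ h" for w g h
  proof (rule ccontr)
    assume "\<not> length w < M + N"
    then have long: "M \<le> length (g @ w)" "N \<le> length (g @ w)" by simp_all
    have hd: "e = v ! 0" if e: "g @ w = x @ (v @ [e]) @ y" for x e y
    proof -
      have len: "length x < length w" using arg_cong[OF e, of length] g(1) v(1) by simp
      have "e = (x @ (v @ [e]) @ y) ! (q + length x)" using v(1) by (simp add: nth_append)
      also have "\<dots> = w ! length x" unfolding e[symmetric] using g(1) by (simp add: nth_append)
      also have "\<dots> = (g @ w) ! length x" unfolding g(3) using len by (simp add: nth_append)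
      also have "\<dots> = v ! 0" unfolding e using v(1) assms by (simp add: nth_append)
      finally show ?thesis .
    qed
    obtain x y where "g @ w = x @ (v @ [c]) @ y" using M g(2) long(1) by blast
    moreover obtain x' y' where "g @ w = x' @ (v @ [d]) @ y'" using N g(2) long(2) by blast
    ultimately show False using hd cd(1) by metis
  qed
  then show ?thesis by blast
qed

text \<open>The equation \<open>g @ w = w @ h\<close> says that \<open>g @ w\<close> has period \<open>|g|\<close>. Choose \<open>w\<close> as long as
  possible. Its two occurrences in \<open>g @ w\<close> then are followed by different letters and preceded by
  different letters, since otherwise the periodic word could be extended.\<close>

lemma periodic_extends_to_bispecial:
  assumes g0: "g0 \<noteq> []" "g0 @ w0 \<in> F" "g0 @ w0 = w0 @ h0"
  shows "\<exists>w g h. bispecial F w \<and> length w0 \<le> length w \<and> length g = length g0 \<and>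
           g @ w \<in> F \<and> g @ w = w @ h"
proof -
  define P where "P w \<longleftrightarrow> (\<exists>g h. length g = length g0 \<and> g @ w \<in> F \<and> g @ w = w @ h)" for w
  have "P w0" using g0 by (auto simp: P_def)
  moreover obtain B where "\<And>w. P w \<Longrightarrow> length w < B"
    using period_bounded[of "length g0"] g0(1) unfolding P_def by (metis One_nat_def Suc_leI length_greater_0_conv)
  ultimately obtain w where w: "P w" and max: "\<And>v. P v \<Longrightarrow> length v \<le> length w"
    using ex_has_greatest_nat[of P w0 length B] by (metis less_imp_le)
  obtain g h where g: "length g = length g0" "g @ w \<in> F" "g @ w = w @ h" using w by (auto simp: P_def)
  have "length h = length g0" using arg_cong[OF g(3), of length] g(1) by simp
  then obtain b h' where b: "h = b # h'" using g0(1) by (cases h) auto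
  obtain e g' where e: "g = g' @ [e]" using g(1) g0(1) by (cases g rule: rev_cases) auto
  have wF: "w \<in> F" using g(2) by (rule suffix_in)
  obtain c where c: "(g @ w) @ [c] \<in> F" using extend_right[OF g(2)] by blast
  have "c \<noteq> b"
  proof
    assume "c = b"
    then have "g @ (w @ [c]) = (w @ [c]) @ (h' @ [c])" using g(3) b by simp
    then have "P (w @ [c])" unfolding P_def using c g(1) by (metis append.assoc)
    then show False using max[of "w @ [c]"] by simp
  qed
  moreover have "w @ [c] \<in> F" using c suffix_in[of g "w @ [c]"] by simp
  moreover have "w @ [b] \<in> F" using g b prefix_in[of "w @ [b]" h'] by simp
  ultimately have right: "right_special F w" using wF unfolding right_special_def by blast
  obtain f where f: "f # (g @ w) \<in> F" using extend_left[OF g(2)] by blast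
  have "f \<noteq> e"
  proof
    assume "f = e"
    then have "(f # g') @ (f # w) = f # (g @ w)" using e by simp
    also have "\<dots> = (f # w) @ h" using g(3) by simp
    finally have "(f # g') @ (f # w) = (f # w) @ h" .
    moreover have "(f # g') @ (f # w) \<in> F" "length (f # g') = length g0"
      using f g(1) e \<open>f = e\<close> by auto
    ultimately have "P (f # w)" unfolding P_def by blast
    then show False using max[of "f # w"] by simp
  qed
  moreover have "f # w \<in> F" using f prefix_in[of "f # w" h] g(3) by simp
  moreover have "e # w \<in> F" using g(2) e suffix_in[of g' "e # w"] by simp
  ultimately have "left_special F w" using wF unfolding left_special_def by blast
  then show ?thesis using right g max[OF \<open>P w0\<close>] unfolding bispecial_def by blast
qed

lemma power_in_return:
  assumes a: "a \<in> {1..k}"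
  shows "word_power (ret n a) (1 + length (bisp n) div length (ret n a)) \<in> F"
proof -
  let ?u = "ret n a" and ?w = "bisp n"
  have "complete_return F ?w a (?u @ ?w)" using return_system_bisp a by (auto simp: return_system_def)
  then obtain t where "?u @ ?w \<in> F" "?u @ ?w = ?w @ a # t" by (auto simp: complete_return_def)
  moreover obtain z where "?w = word_power ?u (length ?w div length ?u) @ z"
    using word_power_prefix[OF calculation(2)] by (metis div_times_less_eq_dividend)
  ultimately have "(?u @ word_power ?u (length ?w div length ?u)) @ z \<in> F" by (metis append.assoc)
  then show ?thesis using prefix_in by (simp add: word_power_Suc)
qed

lemma power_bounded_by_return:
  assumes v: "v \<noteq> []" "word_power v (Suc p) \<in> F"
  shows "\<exists>n a. a \<in> {1..k} \<and> p \<le> length (bisp n) div length (ret n a)"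
proof -
  obtain w g h where w: "bispecial F w" "p * length v \<le> length w" and g: "length g = length v"
    "g @ w \<in> F" "g @ w = w @ h"
    using periodic_extends_to_bispecial[of v "word_power v p" v] v
    by (auto simp: word_power_Suc[symmetric] word_power_Suc2[symmetric] length_word_power)
  obtain n where n: "w = bisp n" using bispecial_eq_bisp w(1) by blast
  have "length h = length v" using arg_cong[OF g(3), of length] g(1) by simp
  then obtain a h' where h: "h = a # h'" using v(1) by (cases h) auto
  have a: "a \<in> {1..k}" using letter_in[of w a h'] g h by simp
  have z: "complete_return F w a (ret n a @ w)"
    using return_system_bisp a n by (auto simp: return_system_def)
  obtain e where e: "(g @ w) @ e \<in> F" "length (ret n a @ w) \<le> length e"
    using extend_right_long[OF g(2)] by blast
  have "w @ a # (h' @ e) \<in> F" using e(1) g(3) h by simp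
  moreover have "length (ret n a @ w) \<le> length (w @ a # (h' @ e))" using e(2) by simp
  ultimately obtain f where "w @ a # (h' @ e) = (ret n a @ w) @ f"
    using complete_return_prefix[OF z] w(1) unfolding bispecial_def by blast
  then have "ret n a @ w @ f = g @ w @ e" using g(3) h by (metis append.assoc append_Cons)
  moreover have "g \<noteq> []" using g(1) v(1) by auto
  ultimately have "length (ret n a) \<le> length v" using complete_return_occurrence[OF z] g(1) by metis
  then have "p * length (ret n a) \<le> length w" using w(2) by (meson le_trans mult_le_mono2)
  then have "p \<le> length (bisp n) div length (ret n a)"
    using d_pos[of n a] n by (simp add: less_eq_div_iff_mult_less_eq)
  then show ?thesis using a by blast
qed

lemma ind_eq:
  assumes X: "language X = F"
  shows "ind k X = Sup {enat (1 + length (bisp n) div length (ret n a)) |n a. a \<in> {1..k}}"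
    (is "_ = Sup ?S")
proof (rule antisym)
  show "ind k X \<le> Sup ?S"
    unfolding ind_def X
  proof (rule Sup_least, clarify)
    fix p v assume p: "p \<ge> (1::nat)" "v \<noteq> []" "word_power v p \<in> F"
    then obtain p' where p': "p = Suc p'" by (cases p) auto
    then obtain n a where na: "a \<in> {1..k}" "p' \<le> length (bisp n) div length (ret n a)"
      using power_bounded_by_return p by blast
    then have "enat p \<le> enat (1 + length (bisp n) div length (ret n a))" using p' by simp
    also have "\<dots> \<le> Sup ?S" using na(1) by (intro Sup_upper) auto
    finally show "enat p \<le> Sup ?S" .
  qed
  show "Sup ?S \<le> ind k X"
  proof (rule Sup_least)
    fix s assume "s \<in> ?S"
    then obtain n a where s: "s = enat (1 + length (bisp n) div length (ret n a))" and a: "a \<in> {1..k}"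
      by blast
    have u: "ret n a \<noteq> []" using d_pos[of n a] by auto
    have "ret n a @ bisp n \<in> F" using return_system_bisp[of n] a
      by (auto simp: return_system_def complete_return_def)
    then have "set (ret n a) \<subseteq> alphabet k" using letters[of "ret n a @ bisp n"] by (simp add: alphabet_def)
    with power_in_return[OF a] u show "s \<le> ind k X"
      unfolding ind_def X s by (intro Sup_upper CollectI exI[of _ "1 + length (bisp n) div length (ret n a)"]) auto
  qed
qed

end

lemma ind_AR_subshift:
  fixes X :: "('i::semiring_1 \<Rightarrow> nat) set"
  assumes "k \<ge> 2" "AR_subshift k X"
  shows "ind k X = max (N1 k (index_seq X)) (N2 k (index_seq X))"
proof -
  interpret AR_language k "language X" by (rule language_AR_subshift[OF assms])
  show ?thesis
    unfolding ind_eq[OF refl] index_seq_eq[OF refl] using directive_letter by (rule Sup_exponents)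
qed

theorem theorem4p1:
  fixes k :: nat
  assumes "k \<ge> 2"
  shows "(\<forall>X :: (nat \<Rightarrow> nat) set. AR_subshift k X \<longrightarrow>
            ind k X = max (N1 k (index_seq X)) (N2 k (index_seq X))) \<and>
         (\<forall>X :: (int \<Rightarrow> nat) set. AR_subshift k X \<longrightarrow>
            ind k X = max (N1 k (index_seq X)) (N2 k (index_seq X)))"
  using ind_AR_subshift[OF assms] ind_AR_subshift[OF assms] by blast

end
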